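(* Let $p,q\ge 1$. The diagonal grid graph $G_{p,q}$ admits a bar 1-visibility drawing $\Gamma$ on an integer grid of size $(q+2p-2)\times(3(p+q)-3)$ (height $\times$ width), i.e. with all bars and edge segments having endpoints at grid points. Furthermore, such a $\Gamma$ can be found in time linear in the number $pq$ of vertices.
   Context: A $p\times q$-grid graph has as vertices the grid points of a $p\times q$ grid in the plane ($p$ rows, $q$ columns; vertex $v_{ij}$ lies on the $i$th row and $j$th column), and as edges the grid-line segments joining consecutive grid points in a row or column. A diagonal grid graph $G_{p,q}$ is a $p\times q$-grid graph in which both diagonal edges are added in every unit cell: if a cell has bottom-left vertex $a$, bottom-right $b$, upper-right $c$ and upper-left $d$, the edges $(a,c)$ and $(b,d)$ are added. A bar 1-visibility drawing of a graph $G$ draws each vertex as a horizontal line segment (a bar), pairwise disjoint, and each edge $(u,v)$ as a vertical line segment whose two endpoints lie on the bars of $u$ and $v$, such that the vertical segment of each edge intersects at most one bar other than the bars of its two end vertices. *)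

theory Defs
  imports "HOL-Analysis.Analysis"
begin

section \<open>Diagonal grid graphs\<close>

text \<open>The vertex in row \<open>i\<close> and column \<open>j\<close> is the pair \<open>(i, j)\<close>; an edge is the set of its two
  end vertices.\<close>

type_synonym vertex = "nat \<times> nat"

definition grid_vertices :: "nat \<Rightarrow> nat \<Rightarrow> vertex set" where
  "grid_vertices p q = {1..p} \<times> {1..q}"

definition grid_edges :: "nat \<Rightarrow> nat \<Rightarrow> vertex set set" where
  "grid_edges p q =
     {{(i, j), (i, j + 1)} | i j. 1 \<le> i \<and> i \<le> p \<and> 1 \<le> j \<and> j < q} \<union>
     {{(i, j), (i + 1, j)} | i j. 1 \<le> i \<and> i < p \<and> 1 \<le> j \<and> j \<le> q}"

definition diagonal_edges :: "nat \<Rightarrow> nat \<Rightarrow> vertex set set" where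
  "diagonal_edges p q =
     {{(i, j), (i + 1, j + 1)} | i j. 1 \<le> i \<and> i < p \<and> 1 \<le> j \<and> j < q} \<union>
     {{(i, j + 1), (i + 1, j)} | i j. 1 \<le> i \<and> i < p \<and> 1 \<le> j \<and> j < q}"

definition diagonal_grid_edges :: "nat \<Rightarrow> nat \<Rightarrow> vertex set set" where
  "diagonal_grid_edges p q = grid_edges p q \<union> diagonal_edges p q"


section \<open>Bar 1-visibility drawings\<close>

text \<open>A segment is given by its two endpoints.  Bars and edge segments are non-degenerate.\<close>

type_synonym point = "real \<times> real"
type_synonym segment = "point \<times> point"

definition points :: "segment \<Rightarrow> point set" where
  "points s = closed_segment (fst s) (snd s)"

definition horizontal :: "segment \<Rightarrow> bool" where
  "horizontal s \<longleftrightarrow> fst s \<noteq> snd s \<and> snd (fst s) = snd (snd s)"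

definition vertical :: "segment \<Rightarrow> bool" where
  "vertical s \<longleftrightarrow> fst s \<noteq> snd s \<and> fst (fst s) = fst (snd s)"

record 'v drawing =
  bar :: "'v \<Rightarrow> segment"
  edge_segment :: "'v set \<Rightarrow> segment"

definition bar_1_visibility_drawing ::
    "'v set \<Rightarrow> 'v set set \<Rightarrow> 'v drawing \<Rightarrow> bool" where
  "bar_1_visibility_drawing V E \<Gamma> \<longleftrightarrow>
     (\<forall>v\<in>V. horizontal (bar \<Gamma> v)) \<and>
     (\<forall>u\<in>V. \<forall>v\<in>V. u \<noteq> v \<longrightarrow> points (bar \<Gamma> u) \<inter> points (bar \<Gamma> v) = {}) \<and>
     (\<forall>e\<in>E. vertical (edge_segment \<Gamma> e)) \<and>
     (\<forall>u v. {u, v} \<in> E \<longrightarrow>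
        (\<exists>a b. edge_segment \<Gamma> {u, v} \<in> {(a, b), (b, a)} \<and>
               a \<in> points (bar \<Gamma> u) \<and> b \<in> points (bar \<Gamma> v))) \<and>
     (\<forall>e\<in>E. \<exists>\<^sub>\<le>\<^sub>1 w. w \<in> V - e \<and> points (edge_segment \<Gamma> e) \<inter> points (bar \<Gamma> w) \<noteq> {})"

text \<open>The size of a grid counts grid points: height \<open>h\<close> means \<open>h\<close> rows, width \<open>w\<close> means \<open>w\<close>
  columns of grid points (just as for a \<open>p \<times> q\<close> grid graph).\<close>

definition integer_grid :: "nat \<Rightarrow> nat \<Rightarrow> point set" where
  "integer_grid h w = (real ` {..<w}) \<times> (real ` {..<h})"

definition drawn_on_grid ::
    "nat \<Rightarrow> nat \<Rightarrow> 'v set \<Rightarrow> 'v set set \<Rightarrow> 'v drawing \<Rightarrow> bool" where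
  "drawn_on_grid h w V E \<Gamma> \<longleftrightarrow>
     (\<forall>v\<in>V. bar \<Gamma> v \<in> integer_grid h w \<times> integer_grid h w) \<and>
     (\<forall>e\<in>E. edge_segment \<Gamma> e \<in> integer_grid h w \<times> integer_grid h w)"


section \<open>Random access machine programs with uniform cost\<close>

text \<open>The primitive operations are those of the random access machine of Cook and Reckhow: an
  integer memory with constants, addition, subtraction, indirect addressing, a test for
  positivity and printing.  Jumps are replaced by structured control flow.  Every primitive
  operation and every test costs one time unit.\<close>

datatype com =
    Const nat int
  | Add nat nat nat
  | Sub nat nat nat
  | Load nat nat
  | Store nat nat
  | Print nat
  | Seq com com
  | IfPos nat com com
  | WhilePos nat com

text \<open>A state is the memory together with the output printed so far.\<close>

type_synonym state = "(nat \<Rightarrow> int) \<times> int list"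

text \<open>\<open>exec c s t s'\<close>: started in \<open>s\<close>, \<open>c\<close> halts in state \<open>s'\<close> after exactly \<open>t\<close> time units.
  There is no rule for access to a negative address, so a program attempting it does not halt.\<close>

inductive exec :: "com \<Rightarrow> state \<Rightarrow> nat \<Rightarrow> state \<Rightarrow> bool" where
  Const: "exec (Const x k) (m, out) 1 (m(x := k), out)"
| Add: "exec (Add x y z) (m, out) 1 (m(x := m y + m z), out)"
| Sub: "exec (Sub x y z) (m, out) 1 (m(x := m y - m z), out)"
| Load: "m y \<ge> 0 \<Longrightarrow> exec (Load x y) (m, out) 1 (m(x := m (nat (m y))), out)"
| Store: "m x \<ge> 0 \<Longrightarrow> exec (Store x y) (m, out) 1 (m(nat (m x) := m y), out)"
| Print: "exec (Print x) (m, out) 1 (m, out @ [m x])"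
| Seq: "exec c1 s t1 s1 \<Longrightarrow> exec c2 s1 t2 s2 \<Longrightarrow> exec (Seq c1 c2) s (t1 + t2) s2"
| IfPos: "fst s x > 0 \<Longrightarrow> exec c1 s t s' \<Longrightarrow> exec (IfPos x c1 c2) s (1 + t) s'"
| IfNonpos: "fst s x \<le> 0 \<Longrightarrow> exec c2 s t s' \<Longrightarrow> exec (IfPos x c1 c2) s (1 + t) s'"
| WhilePos: "fst s x > 0 \<Longrightarrow> exec c s t1 s1 \<Longrightarrow> exec (WhilePos x c) s1 t2 s2 \<Longrightarrow>
    exec (WhilePos x c) s (1 + t1 + t2) s2"
| WhileNonpos: "fst s x \<le> 0 \<Longrightarrow> exec (WhilePos x c) s 1 s"

text \<open>The input \<open>p, q\<close> is placed in cells 0 and 1; all other cells are 0.\<close>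

definition input_state :: "nat \<Rightarrow> nat \<Rightarrow> state" where
  "input_state p q = ((\<lambda>_. 0)(0 := int p, 1 := int q), [])"

text \<open>A drawing is printed as one record per bar, listing the vertex and the endpoints of its bar,
  followed by one record per edge, listing its end vertices and the endpoints of its segment.
  The order of the records and the order of the two ends of an edge are free.\<close>

fun vertex_code :: "vertex \<Rightarrow> real list" where
  "vertex_code (i, j) = [real i, real j]"

fun segment_code :: "segment \<Rightarrow> real list" where
  "segment_code ((x1, y1), (x2, y2)) = [x1, y1, x2, y2]"

definition bar_record :: "vertex drawing \<Rightarrow> vertex \<Rightarrow> real list" where
  "bar_record \<Gamma> v = vertex_code v @ segment_code (bar \<Gamma> v)"

definition edge_record :: "vertex drawing \<Rightarrow> vertex \<times> vertex \<Rightarrow> real list" where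
  "edge_record \<Gamma> e = vertex_code (fst e) @ vertex_code (snd e) @
     segment_code (edge_segment \<Gamma> {fst e, snd e})"

definition encodes_drawing ::
    "int list \<Rightarrow> vertex set \<Rightarrow> vertex set set \<Rightarrow> vertex drawing \<Rightarrow> bool" where
  "encodes_drawing out V E \<Gamma> \<longleftrightarrow>
     (\<exists>vs es.
        distinct vs \<and> set vs = V \<and>
        distinct (map (\<lambda>(u, v). {u, v}) es) \<and> set (map (\<lambda>(u, v). {u, v}) es) = E \<and>
        map real_of_int out =
          concat (map (bar_record \<Gamma>) vs) @ concat (map (edge_record \<Gamma>) es))"

end

theory Submission
  imports Defs
begin

text \<open>Put the bar of \<open>(i, j)\<close> on level \<open>j + 2 i - 3\<close>, around column \<open>3 (p + j - i - 1)\<close>, with three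
  columns on either side.  Bars on a common level are at least nine columns apart, so they leave
  gaps of two columns.  Every edge climbs at most three levels.  Only the diagonals from \<open>(i, j)\<close>
  to \<open>(i + 1, j + 1)\<close> climb three, and they can be routed through a gap of the first
  level that they cross.  All other edges cross at most one level.  Just two corner
  bars have to be clipped to fit the width.\<close>

section \<open>Placement of bars and edge segments\<close>

section \<open>The drawing\<close>

definition level :: "vertex \<Rightarrow> int" where
  "level v = int (snd v) + 2 * int (fst v) - 3"

text \<open>The shifts here and in \<open>level\<close> are normalisations: \<open>(1, 1)\<close>
  gets level 0 and \<open>(p, 1)\<close> gets column 0, the smallest values that occur.\<close>

definition column :: "nat \<Rightarrow> vertex \<Rightarrow> int" where
  "column p v = 3 * (int p + int (snd v) - int (fst v) - 1)"

definition bar_left :: "nat \<Rightarrow> vertex \<Rightarrow> int" where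
  "bar_left p v = max 0 (column p v - 3)"

text \<open>Columns are numbered from 0, so a width of 3 (p + q) - 3 ends at column 3 (p + q) - 4.
  This is one short of the unclipped right end of the bar of \<open>(1, q)\<close>.\<close>

definition bar_right :: "nat \<Rightarrow> nat \<Rightarrow> vertex \<Rightarrow> int" where
  "bar_right p q v = min (column p v + 3) (3 * (int p + int q) - 4)"

definition upward :: "vertex \<Rightarrow> vertex \<Rightarrow> bool" where
  "upward u v \<longleftrightarrow>
     fst v = fst u \<and> snd v = snd u + 1 \<or>
     fst v = fst u + 1 \<and> (snd v = snd u \<or> snd v = snd u + 1 \<or> snd v + 1 = snd u)"

text \<open>With c the column of \<open>u\<close>, the bars one level above \<open>u\<close> leave
  free the columns c - 2 and c - 1. The offset 1 sends the steep diagonal through that gap; the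
  offset 3 is the left end of the unclipped bar of \<open>u\<close>.\<close>

definition edge_column :: "nat \<Rightarrow> vertex \<Rightarrow> vertex \<Rightarrow> int" where
  "edge_column p u v = column p u -
     (if fst u = fst v \<or> snd u = snd v then 0 else if snd u < snd v then 1 else 3)"

definition upward_segment :: "nat \<Rightarrow> vertex \<times> vertex \<Rightarrow> segment" where
  "upward_segment p e =
     (let x = real_of_int (edge_column p (fst e) (snd e))
      in ((x, real_of_int (level (fst e))), (x, real_of_int (level (snd e)))))"

text \<open>Edges are unordered sets, whereas a segment is computed from its lower end.
  \<open>THE\<close> recovers the orientation, which is unique by
  \<open>upward_unique\<close>.\<close>

definition grid_drawing :: "nat \<Rightarrow> nat \<Rightarrow> vertex drawing" where
  "grid_drawing p q =
     \<lparr>bar = (\<lambda>v. ((real_of_int (bar_left p v), real_of_int (level v)),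
                  (real_of_int (bar_right p q v), real_of_int (level v)))),
      edge_segment =
        (\<lambda>e. upward_segment p (THE d. {fst d, snd d} = e \<and> upward (fst d) (snd d)))\<rparr>"

section \<open>Segments as boxes and the upward orientation of edges\<close>

lemma closed_segment_horizontal:
  fixes a b y :: real
  assumes "a \<le> b"
  shows "closed_segment (a, y) (b, y) = {a..b} \<times> {y}"
proof -
  have "closed_segment (a, y) (b, y) = (\<lambda>x. (x, y)) ` closed_segment a b"
    by (simp add: closed_segment_image_interval image_image algebra_simps)
  then show ?thesis
    using assms by (auto simp: closed_segment_eq_real_ivl)
qed

lemma closed_segment_vertical:
  fixes a b x :: real
  assumes "a \<le> b"
  shows "closed_segment (x, a) (x, b) = {x} \<times> {a..b}"
proof -
  have "closed_segment (x, a) (x, b) = Pair x ` closed_segment a b"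
    by (simp add: closed_segment_image_interval image_image algebra_simps)
  then show ?thesis
    using assms by (auto simp: closed_segment_eq_real_ivl)
qed

lemma upward_level: "upward u v \<Longrightarrow> level u < level v"
  by (auto simp: upward_def level_def)

text \<open>The level strictly increases along \<open>upward\<close>, so the two ends cannot be
  swapped.\<close>

lemma upward_unique:
  assumes "upward u v" "upward u' v'" "{u, v} = {u', v'}"
  shows "u = u' \<and> v = v'"
  using upward_level[OF assms(1)] upward_level[OF assms(2)] assms(3)
  unfolding doubleton_eq_iff by force

lemma edge_segment_upward:
  assumes "upward u v"
  shows "edge_segment (grid_drawing p q) {u, v} = upward_segment p (u, v)"
proof -
  have "(THE d. {fst d, snd d} = {u, v} \<and> upward (fst d) (snd d)) = (u, v)"
  proof (rule the_equality)
    fix d assume "{fst d, snd d} = {u, v} \<and> upward (fst d) (snd d)"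
    then have "fst d = u \<and> snd d = v"
      using upward_unique[OF _ assms] by blast
    then show "d = (u, v)"
      by (simp add: prod_eq_iff)
  qed (simp add: assms)
  then show ?thesis
    by (simp add: grid_drawing_def)
qed

text \<open>The alternatives in \<open>upward\<close> are exactly the four families of edges. From
  here on every edge is handled through its oriented pair.\<close>

lemma diagonal_grid_edges_upward:
  "diagonal_grid_edges p q =
     {{u, v} | u v. u \<in> grid_vertices p q \<and> v \<in> grid_vertices p q \<and> upward u v}"
  (is "?E = ?F")
proof
  show "?E \<subseteq> ?F"
    by (fastforce simp: diagonal_grid_edges_def grid_edges_def diagonal_edges_def
        grid_vertices_def upward_def)
  show "?F \<subseteq> ?E"
  proof
    fix e assume "e \<in> ?F"
    then obtain i j k l where e: "e = {(i, j), (k, l)}" "upward (i, j) (k, l)"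
      and V: "(i, j) \<in> grid_vertices p q" "(k, l) \<in> grid_vertices p q" by auto
    from e(2) consider "k = i" "l = j + 1" | "k = i + 1" "l = j" | "k = i + 1" "l = j + 1"
      | "k = i + 1" "j = l + 1" by (auto simp: upward_def)
    then show "e \<in> ?E"
    proof cases
      case 1
      then have "e \<in> {{(i, j), (i, j + 1)} | i j. 1 \<le> i \<and> i \<le> p \<and> 1 \<le> j \<and> j < q}"
        using e(1) V unfolding grid_vertices_def by force
      then show ?thesis unfolding diagonal_grid_edges_def grid_edges_def by blast
    next
      case 2
      then have "e \<in> {{(i, j), (i + 1, j)} | i j. 1 \<le> i \<and> i < p \<and> 1 \<le> j \<and> j \<le> q}"
        using e(1) V unfolding grid_vertices_def by force
      then show ?thesis unfolding diagonal_grid_edges_def grid_edges_def by blast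
    next
      case 3
      then have "e \<in> {{(i, j), (i + 1, j + 1)} | i j. 1 \<le> i \<and> i < p \<and> 1 \<le> j \<and> j < q}"
        using e(1) V unfolding grid_vertices_def by force
      then show ?thesis unfolding diagonal_grid_edges_def diagonal_edges_def by blast
    next
      case 4
      \<comment> \<open>This family is indexed by the smaller of the two column numbers, which is
        \<open>l\<close> here.\<close>
      then have "e = {(i, l + 1), (i + 1, l)}" "1 \<le> i" "i < p" "1 \<le> l" "l < q"
        using e(1) V by (simp_all add: grid_vertices_def)
      then have "e \<in> {{(i, j + 1), (i + 1, j)} | i j. 1 \<le> i \<and> i < p \<and> 1 \<le> j \<and> j < q}"
        by blast
      then show ?thesis unfolding diagonal_grid_edges_def diagonal_edges_def by blast
    qed
  qed
qed

section \<open>Disjoint bars and at most one crossing\<close>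

lemma bar_left_less_right: "v \<in> grid_vertices p q \<Longrightarrow> bar_left p v < bar_right p q v"
  by (auto simp: grid_vertices_def bar_left_def bar_right_def column_def)

lemma points_bar:
  assumes "v \<in> grid_vertices p q"
  shows "points (bar (grid_drawing p q) v) =
    {real_of_int (bar_left p v)..real_of_int (bar_right p q v)} \<times> {real_of_int (level v)}"
  using bar_left_less_right[OF assms]
  by (simp add: grid_drawing_def points_def closed_segment_horizontal)

lemma points_upward_segment:
  assumes "upward u v"
  shows "points (upward_segment p (u, v)) =
    {real_of_int (edge_column p u v)} \<times> {real_of_int (level u)..real_of_int (level v)}"
  using upward_level[OF assms]
  by (simp add: upward_segment_def Let_def points_def closed_segment_vertical)

text \<open>On a common level, rows differing by d force columns differing by 9 d, while two bars
  sharing a column have centres at most 6 apart. Hence d = 0. Clipping only shortens bars.\<close>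

lemma bars_on_level_disjoint:
  assumes "level u = level v" "u \<noteq> v" "bar_left p u \<le> x" "x \<le> bar_right p q u"
    "bar_left p v \<le> x" "x \<le> bar_right p q v"
  shows False
proof -
  have l: "int (snd u) + 2 * int (fst u) = int (snd v) + 2 * int (fst v)"
    using assms(1) by (simp add: level_def)
  have c: "column p u - 3 \<le> column p v + 3" "column p v - 3 \<le> column p u + 3"
    using assms(3-6) by (auto simp: bar_left_def bar_right_def)
  from l c(1) have "int (fst v) \<le> int (fst u)"
    unfolding column_def by (simp add: algebra_simps)
  moreover from l c(2) have "int (fst u) \<le> int (fst v)"
    unfolding column_def by (simp add: algebra_simps)
  ultimately have "u = v"
    using l by (simp add: prod_eq_iff)
  with assms(2) show False by simp
qed

text \<open>Relative to the centre of \<open>v\<close>, the edge stands at -3 (same row), 3 (same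
  column), -1 (steep diagonal) or 3 (other diagonal), so it stays within three columns of both
  centres. Clipping is harmless: no edge attaches left of the centre of \<open>(p, 1)\<close> or at
  the right end of \<open>(1, q)\<close>.\<close>

lemma edge_column_in_bars:
  assumes "u \<in> grid_vertices p q" "v \<in> grid_vertices p q" "upward u v"
  shows "bar_left p u \<le> edge_column p u v" "edge_column p u v \<le> bar_right p q u"
    "bar_left p v \<le> edge_column p u v" "edge_column p u v \<le> bar_right p q v"
  using assms by (auto simp: grid_vertices_def upward_def bar_left_def bar_right_def column_def
      edge_column_def)

text \<open>Let d be the row of \<open>w\<close> minus that of \<open>u\<close>. One level above
  \<open>u\<close>, the centre of \<open>w\<close> is 3 - 9 d columns to the right of that of
  \<open>u\<close>; covering the edge at offset -1 would need 1 \<le> 9 d \<le> 7, which no integer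
  satisfies.\<close>

lemma diagonal_passes_gap:
  assumes "upward u v" "level v = level u + 3"
    "bar_left p w \<le> edge_column p u v" "edge_column p u v \<le> bar_right p q w"
  shows "level w \<noteq> level u + 1"
proof
  assume l: "level w = level u + 1"
  have "snd v = snd u + 1" "fst v = fst u + 1"
    using assms by (auto simp: upward_def level_def)
  then have "edge_column p u v = column p u - 1"
    by (simp add: edge_column_def)
  with assms(3,4) have c: "column p w - 3 \<le> column p u - 1" "column p u - 1 \<le> column p w + 3"
    by (auto simp: bar_left_def bar_right_def)
  have "\<not> int (fst u) < int (fst w)"
    using l c(2) unfolding column_def level_def by (simp add: algebra_simps)
  moreover have "\<not> int (fst w) \<le> int (fst u)"
    using l c(1) unfolding column_def level_def by (simp add: algebra_simps)
  ultimately show False by simp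
qed

text \<open>The levels of \<open>u\<close> and \<open>v\<close> are blocked by their own bars, so at
  most two levels lie strictly between. If there are two, the gap rules out the lower one. Thus
  \<open>w\<close> and \<open>w'\<close> share a level and a column.\<close>

lemma upward_crosses_at_most_one:
  assumes uv: "u \<in> grid_vertices p q" "v \<in> grid_vertices p q" "upward u v"
    and w: "w \<notin> {u, v}" "level u \<le> level w" "level w \<le> level v"
      "bar_left p w \<le> edge_column p u v" "edge_column p u v \<le> bar_right p q w"
    and w': "w' \<notin> {u, v}" "level u \<le> level w'" "level w' \<le> level v"
      "bar_left p w' \<le> edge_column p u v" "edge_column p u v \<le> bar_right p q w'"
  shows "w = w'"
proof -
  note col = edge_column_in_bars[OF uv]
  have ne: "level w \<noteq> level u" "level w \<noteq> level v" "level w' \<noteq> level u" "level w' \<noteq> level v"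
    using bars_on_level_disjoint[of w u] bars_on_level_disjoint[of w v]
      bars_on_level_disjoint[of w' u] bars_on_level_disjoint[of w' v] col w w' by blast+
  have "level v \<le> level u + 3"
    using uv(3) by (auto simp: upward_def level_def)
  moreover have "level v = level u + 3 \<Longrightarrow> level w \<noteq> level u + 1 \<and> level w' \<noteq> level u + 1"
    using diagonal_passes_gap uv(3) w(4,5) w'(4,5) by blast
  ultimately have "level w = level w'"
    using ne w w' by linarith
  then show ?thesis
    using bars_on_level_disjoint w(4,5) w'(4,5) by blast
qed

lemma grid_drawing_visibility:
  "bar_1_visibility_drawing (grid_vertices p q) (diagonal_grid_edges p q) (grid_drawing p q)"
  (is "bar_1_visibility_drawing ?V ?E ?G")
  unfolding bar_1_visibility_drawing_def
proof (intro conjI ballI allI impI)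
  fix v assume "v \<in> ?V"
  from bar_left_less_right[OF this] show "horizontal (bar ?G v)"
    by (simp add: horizontal_def grid_drawing_def)
next
  fix u v assume uv: "u \<in> ?V" "v \<in> ?V" "u \<noteq> v"
  show "points (bar ?G u) \<inter> points (bar ?G v) = {}"
  proof (rule ccontr)
    assume "\<not> ?thesis"
    then obtain x where l: "level u = level v"
      and "real_of_int (bar_left p u) \<le> x" "x \<le> real_of_int (bar_right p q u)"
      "real_of_int (bar_left p v) \<le> x" "x \<le> real_of_int (bar_right p q v)"
      using uv by (auto simp: points_bar)
    \<comment> \<open>The ends of bars are integers, so the floor of a common abscissa is again
      common to both bars.\<close>
    then have "bar_left p u \<le> \<lfloor>x\<rfloor>" "\<lfloor>x\<rfloor> \<le> bar_right p q u"
      "bar_left p v \<le> \<lfloor>x\<rfloor>" "\<lfloor>x\<rfloor> \<le> bar_right p q v"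
      by (simp_all only: le_floor_iff) linarith+
    with l uv(3) show False
      using bars_on_level_disjoint by blast
  qed
next
  fix e assume "e \<in> ?E"
  then obtain u v where "e = {u, v}" and up: "upward u v"
    unfolding diagonal_grid_edges_upward by blast
  then show "vertical (edge_segment ?G e)"
    using upward_level[OF up]
    by (simp add: edge_segment_upward vertical_def upward_segment_def Let_def)
next
  fix a b assume "{a, b} \<in> ?E"
  then obtain u v where ab: "{a, b} = {u, v}"
    and uv: "u \<in> ?V" "v \<in> ?V" and up: "upward u v"
    unfolding diagonal_grid_edges_upward by blast
  let ?x = "real_of_int (edge_column p u v)"
  let ?P = "(?x, real_of_int (level u))" and ?Q = "(?x, real_of_int (level v))"
  have "?P \<in> points (bar ?G u)" "?Q \<in> points (bar ?G v)"
    using uv edge_column_in_bars[OF uv up] by (auto simp: points_bar)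
  moreover have seg: "edge_segment ?G {a, b} = (?P, ?Q)"
    by (simp add: ab edge_segment_upward[OF up] upward_segment_def Let_def)
  \<comment> \<open>\<open>{a, b}\<close> may name the upper end first; the swapped pair in the goal
    covers this.\<close>
  moreover have "a = u \<and> b = v \<or> a = v \<and> b = u"
    using ab by (simp add: doubleton_eq_iff)
  ultimately show "\<exists>c d. edge_segment ?G {a, b} \<in> {(c, d), (d, c)} \<and>
      c \<in> points (bar ?G a) \<and> d \<in> points (bar ?G b)"
    unfolding seg by (elim disjE conjE) (hypsubst, fastforce)+
next
  fix e assume "e \<in> ?E"
  then obtain u v where e: "e = {u, v}" and uv: "u \<in> ?V" "v \<in> ?V" and up: "upward u v"
    unfolding diagonal_grid_edges_upward by blast
  have meet: "w \<notin> {u, v} \<and> level u \<le> level w \<and> level w \<le> level v \<and>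
      bar_left p w \<le> edge_column p u v \<and> edge_column p u v \<le> bar_right p q w"
    if "w \<in> ?V - e \<and> points (edge_segment ?G e) \<inter> points (bar ?G w) \<noteq> {}" for w
    using that by (auto simp: e edge_segment_upward[OF up] points_upward_segment[OF up] points_bar)
  show "\<exists>\<^sub>\<le>\<^sub>1 w. w \<in> ?V - e \<and> points (edge_segment ?G e) \<inter> points (bar ?G w) \<noteq> {}"
  proof (rule Uniq_I)
    fix w w'
    assume w: "w \<in> ?V - e \<and> points (edge_segment ?G e) \<inter> points (bar ?G w) \<noteq> {}"
      and w': "w' \<in> ?V - e \<and> points (edge_segment ?G e) \<inter> points (bar ?G w') \<noteq> {}"
    show "w = w'"
      using meet[OF w] meet[OF w'] upward_crosses_at_most_one[OF uv up] by blast
  qed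
qed

section \<open>Size of the grid\<close>

lemma in_integer_grid:
  assumes "0 \<le> x" "x < int w" "0 \<le> y" "y < int h"
  shows "(real_of_int x, real_of_int y) \<in> integer_grid h w"
proof -
  have "real_of_int x = real (nat x)" "real_of_int y = real (nat y)" "nat x < w" "nat y < h"
    using assms by auto
  then show ?thesis
    unfolding integer_grid_def by blast
qed

lemma level_bounds:
  assumes "v \<in> grid_vertices p q"
  shows "0 \<le> level v" "level v < int (q + 2 * p - 2)"
  using assms by (auto simp: grid_vertices_def level_def)

lemma bar_bounds:
  assumes "v \<in> grid_vertices p q"
  shows "0 \<le> bar_left p v" "bar_right p q v < int (3 * (p + q) - 3)"
  using assms by (auto simp: grid_vertices_def bar_left_def bar_right_def)

lemma grid_drawing_on_grid:
  "drawn_on_grid (q + 2 * p - 2) (3 * (p + q) - 3)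
     (grid_vertices p q) (diagonal_grid_edges p q) (grid_drawing p q)"
  (is "drawn_on_grid ?h ?w ?V ?E ?G")
  unfolding drawn_on_grid_def
proof (intro conjI ballI)
  fix v assume v: "v \<in> ?V"
  from bar_left_less_right[OF v] bar_bounds[OF v] level_bounds[OF v]
  show "bar ?G v \<in> integer_grid ?h ?w \<times> integer_grid ?h ?w"
    by (auto simp: grid_drawing_def intro!: in_integer_grid)
next
  fix e assume "e \<in> ?E"
  then obtain u v where e: "e = {u, v}" and uv: "u \<in> ?V" "v \<in> ?V" and up: "upward u v"
    unfolding diagonal_grid_edges_upward by blast
  \<comment> \<open>An edge stands on the bar of \<open>u\<close>, so the horizontal bounds for that
    bar also bound the edge.\<close>
  from edge_column_in_bars[OF uv up] bar_bounds[OF uv(1)] level_bounds[OF uv(1)]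
    level_bounds[OF uv(2)]
  show "edge_segment ?G e \<in> integer_grid ?h ?w \<times> integer_grid ?h ?w"
    by (auto simp: e edge_segment_upward[OF up] upward_segment_def Let_def
        intro!: in_integer_grid)
qed

section \<open>Loop-free programs and counted loops\<close>

section \<open>The program\<close>

text \<open>No memory is needed apart from registers, so the loop bodies have neither loops nor indirect
  addressing.  Such programs run in bounded time.\<close>

primrec straight :: "com \<Rightarrow> bool" where
  "straight (Const x k) = True"
| "straight (Add x y z) = True"
| "straight (Sub x y z) = True"
| "straight (Load x y) = False"
| "straight (Store x y) = False"
| "straight (Print x) = True"
| "straight (Seq c d) = (straight c \<and> straight d)"
| "straight (IfPos x c d) = (straight c \<and> straight d)"
| "straight (WhilePos x c) = False"

text \<open>A functional semantics for \<open>straight\<close> programs; the constructors that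
  \<open>straight\<close> excludes get the default value \<open>s\<close>.\<close>

primrec run :: "com \<Rightarrow> state \<Rightarrow> state" where
  "run (Const x k) s = ((fst s)(x := k), snd s)"
| "run (Add x y z) s = ((fst s)(x := fst s y + fst s z), snd s)"
| "run (Sub x y z) s = ((fst s)(x := fst s y - fst s z), snd s)"
| "run (Load x y) s = s"
| "run (Store x y) s = s"
| "run (Print x) s = (fst s, snd s @ [fst s x])"
| "run (Seq c d) s = run d (run c s)"
| "run (IfPos x c d) s = (if fst s x > 0 then run c s else run d s)"
| "run (WhilePos x c) s = s"

text \<open>The bound \<open>T\<close> is chosen before the state, so a loop body costs constant
  time whatever \<open>p\<close> and \<open>q\<close> are. Bounds add up along the structure of the
  program; for a conditional the sum of both branches is a crude but sufficient bound.\<close>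

lemma exec_straight:
  assumes "straight c"
  shows "\<exists>T. \<forall>s. \<exists>t\<le>T. exec c s t (run c s)"
  using assms
proof (induction c)
  case (Seq c d)
  then obtain T U where T: "\<And>s. \<exists>t\<le>T. exec c s t (run c s)"
    and U: "\<And>s. \<exists>t\<le>U. exec d s t (run d s)"
    by auto
  have "\<exists>t\<le>T + U. exec (Seq c d) s t (run (Seq c d) s)" for s
  proof -
    obtain t u where "t \<le> T" "exec c s t (run c s)"
      "u \<le> U" "exec d (run c s) u (run d (run c s))"
      using T U by blast
    then show ?thesis
      by (intro exI[of _ "t + u"]) (auto intro: exec.Seq)
  qed
  then show ?case by blast
next
  case (IfPos x c d)
  then obtain T U where T: "\<And>s. \<exists>t\<le>T. exec c s t (run c s)"
    and U: "\<And>s. \<exists>t\<le>U. exec d s t (run d s)"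
    by auto
  have "\<exists>t\<le>1 + T + U. exec (IfPos x c d) s t (run (IfPos x c d) s)" for s
  proof (cases "fst s x > 0")
    case True
    obtain t where "t \<le> T" "exec c s t (run c s)"
      using T by blast
    with True show ?thesis
      by (intro exI[of _ "1 + t"]) (auto intro: exec.IfPos[simplified])
  next
    case False
    obtain t where "t \<le> U" "exec d s t (run d s)"
      using U by blast
    with False show ?thesis
      by (intro exI[of _ "1 + t"]) (auto intro: exec.IfNonpos[simplified])
  qed
  then show ?case by blast
next
  case (Const x k)
  have "exec (Const x k) s 1 (run (Const x k) s)" for s
    using exec.Const[of x k "fst s" "snd s"] by simp
  then show ?case by blast
next
  case (Add x y z)
  have "exec (Add x y z) s 1 (run (Add x y z) s)" for s
    using exec.Add[of x y z "fst s" "snd s"] by simp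
  then show ?case by blast
next
  case (Sub x y z)
  have "exec (Sub x y z) s 1 (run (Sub x y z) s)" for s
    using exec.Sub[of x y z "fst s" "snd s"] by simp
  then show ?case by blast
next
  case (Print x)
  have "exec (Print x) s 1 (run (Print x) s)" for s
    using exec.Print[of x "fst s" "snd s"] by simp
  then show ?case by blast
qed simp_all

text \<open>\<open>Inv\<close> is indexed by the number of remaining rounds, which is the value of
  the counter. Each round costs one test besides the body, and the final failing test adds
  1.\<close>

lemma exec_countdown:
  assumes step: "\<And>k s. Inv (Suc k) s \<Longrightarrow> \<exists>s' t. t \<le> T \<and> exec c s t s' \<and> Inv k s'"
    and counter: "\<And>k s. Inv k s \<Longrightarrow> fst s x = int k"
    and "Inv n s"
  shows "\<exists>s' t. t \<le> n * (T + 1) + 1 \<and> exec (WhilePos x c) s t s' \<and> Inv 0 s'"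
  using \<open>Inv n s\<close>
proof (induction n arbitrary: s)
  case 0
  from counter[OF 0] have "exec (WhilePos x c) s 1 s"
    by (intro exec.WhileNonpos) simp
  with 0 show ?case
    by (intro exI[of _ s] exI[of _ 1]) simp
next
  case (Suc n)
  obtain s1 t1 where 1: "t1 \<le> T" "exec c s t1 s1" "Inv n s1"
    using step[OF Suc.prems] by blast
  obtain s2 t2 where 2: "t2 \<le> n * (T + 1) + 1" "exec (WhilePos x c) s1 t2 s2" "Inv 0 s2"
    using Suc.IH[OF 1(3)] by blast
  have "exec (WhilePos x c) s (1 + t1 + t2) s2"
    using counter[OF Suc.prems] 1(2) 2(2) by (intro exec.WhilePos) simp_all
  moreover have "1 + t1 + t2 \<le> Suc n * (T + 1) + 1"
    using 1(1) 2(1) by simp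
  ultimately show ?case
    using 2(3) by blast
qed

text \<open>Copying is simulated by clearing and adding; distinct cells ensure that clearing does
  not destroy the source.\<close>

lemma exec_copy:
  assumes "x \<noteq> y"
  shows "exec (Seq (Const x 0) (Add x x y)) (m, out) 2 (m(x := m y), out)"
proof -
  have "exec (Seq (Const x 0) (Add x x y)) (m, out) (1 + 1)
      (m(x := 0, x := (m(x := 0)) x + (m(x := 0)) y), out)"
    by (rule exec.Seq[OF exec.Const exec.Add])
  then show ?thesis
    using assms by (simp add: numeral_2_eq_2)
qed

section \<open>Traversal of the grid by two nested loops\<close>

definition countdown :: "nat \<Rightarrow> nat list" where
  "countdown n = rev [1..<Suc n]"

lemma countdown_simps [simp]:
  "countdown 0 = []"
  "countdown (Suc n) = Suc n # countdown n"
  by (simp_all add: countdown_def)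

definition grid_list :: "nat \<Rightarrow> nat \<Rightarrow> vertex list" where
  "grid_list p q = List.product (countdown p) (countdown q)"

lemma set_grid_list: "set (grid_list p q) = grid_vertices p q"
  by (auto simp: grid_list_def countdown_def grid_vertices_def)

lemma distinct_grid_list: "distinct (grid_list p q)"
  by (simp add: grid_list_def countdown_def distinct_product)

definition for_grid :: "com \<Rightarrow> com" where
  "for_grid body =
     Seq (Seq (Const 2 0) (Add 2 2 0))
       (WhilePos 2
         (Seq (Seq (Const 3 0) (Add 3 3 1))
           (Seq (WhilePos 3 (Seq body (Sub 3 3 4))) (Sub 2 2 4))))"

text \<open>Cells 2 and 3 hold the current row and column. Cell 4 holds the constant 1, because
  decrementing means subtracting a cell.\<close>

definition registers :: "nat \<Rightarrow> nat \<Rightarrow> nat \<Rightarrow> nat \<Rightarrow> (nat \<Rightarrow> int) \<Rightarrow> bool" where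
  "registers p q i j m \<longleftrightarrow>
     m 0 = int p \<and> m 1 = int q \<and> m 2 = int i \<and> m 3 = int j \<and> m 4 = 1"

text \<open>The contract for a loop body: \<open>m\<close> is arbitrary outside the registers, so
  scratch cells may hold leftovers from earlier rounds.\<close>

definition prints_at :: "nat \<Rightarrow> nat \<Rightarrow> com \<Rightarrow> (vertex \<Rightarrow> int list) \<Rightarrow> bool" where
  "prints_at p q body f \<longleftrightarrow>
     (\<forall>i\<in>{1..p}. \<forall>j\<in>{1..q}. \<forall>m out. registers p q i j m \<longrightarrow>
        (\<exists>m'. run body (m, out) = (m', out @ f (i, j)) \<and> registers p q i j m'))"

lemma exec_grid_row:
  assumes body: "\<And>s. \<exists>t\<le>T. exec body s t (run body s)"
    and f: "prints_at p q body f"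
    and i: "i \<in> {1..p}"
    and m: "registers p q i q m"
  shows "\<exists>t m'. t \<le> q * (T + 2) + 1 \<and> registers p q i 0 m' \<and>
    exec (WhilePos 3 (Seq body (Sub 3 3 4))) (m, out) t
      (m', out @ concat (map (\<lambda>j. f (i, j)) (countdown q)))"
proof -
  define goal where "goal = out @ concat (map (\<lambda>j. f (i, j)) (countdown q))"
  \<comment> \<open>The final output is fixed in advance: what is printed so far, followed by what
    the remaining \<open>k\<close> columns contribute, always equals \<open>goal\<close>.\<close>
  define Inv where "Inv k s \<longleftrightarrow> k \<le> q \<and> registers p q i k (fst s) \<and>
    snd s @ concat (map (\<lambda>j. f (i, j)) (countdown k)) = goal" for k and s :: state
  have "\<exists>s' t. t \<le> T + 1 \<and> exec (Seq body (Sub 3 3 4)) s t s' \<and> Inv k s'"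
    if "Inv (Suc k) s" for k s
  proof -
    obtain m out where s: "s = (m, out)" by fastforce
    have reg: "registers p q i (Suc k) m" and k: "Suc k \<in> {1..q}"
      and out: "out @ f (i, Suc k) @ concat (map (\<lambda>j. f (i, j)) (countdown k)) = goal"
      using that by (auto simp: Inv_def s)
    obtain m' where m': "run body s = (m', out @ f (i, Suc k))" "registers p q i (Suc k) m'"
      using f i k reg unfolding prints_at_def s by blast
    obtain t where t: "t \<le> T" "exec body s t (m', out @ f (i, Suc k))"
      using body[of s] m'(1) by auto
    have "exec (Seq body (Sub 3 3 4)) s (t + 1) (m'(3 := m' 3 - m' 4), out @ f (i, Suc k))"
      by (rule exec.Seq[OF t(2) exec.Sub])
    moreover have "Inv k (m'(3 := m' 3 - m' 4), out @ f (i, Suc k))"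
      using m'(2) k out by (auto simp: Inv_def registers_def)
    ultimately show ?thesis
      using t(1) by (meson add_le_mono1)
  qed
  moreover have "fst s 3 = int k" if "Inv k s" for k s
    using that by (simp add: Inv_def registers_def)
  moreover have "Inv q (m, out)"
    using m by (simp add: Inv_def goal_def)
  ultimately have "\<exists>s' t. t \<le> q * (T + 1 + 1) + 1 \<and>
      exec (WhilePos 3 (Seq body (Sub 3 3 4))) (m, out) t s' \<and> Inv 0 s'"
    by (rule exec_countdown)
  then show ?thesis
    by (fastforce simp: Inv_def goal_def)
qed

lemma exec_for_grid:
  assumes "straight body"
  shows "\<exists>c. \<forall>p q f m out. 1 \<le> p \<and> 1 \<le> q \<and> prints_at p q body f \<and>
      m 0 = int p \<and> m 1 = int q \<and> m 4 = 1 \<longrightarrow>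
    (\<exists>t m'. t \<le> c * (p * q) \<and> m' 0 = int p \<and> m' 1 = int q \<and> m' 4 = 1 \<and>
      exec (for_grid body) (m, out) t (m', out @ concat (map f (grid_list p q))))"
proof -
  obtain T where body: "\<And>s. \<exists>t\<le>T. exec body s t (run body s)"
    using exec_straight[OF assms] by blast
  have "\<exists>t m'. t \<le> (T + 10) * (p * q) \<and> m' 0 = int p \<and> m' 1 = int q \<and> m' 4 = 1 \<and>
      exec (for_grid body) (m, out) t (m', out @ concat (map f (grid_list p q)))"
    if pq: "1 \<le> p" "1 \<le> q" and f: "prints_at p q body f"
      and m: "m 0 = int p" "m 1 = int q" "m 4 = 1" for p q f m out
  proof -
    define goal where "goal = out @ concat (map f (grid_list p q))"
    define row where "row i = concat (map (\<lambda>j. f (i, j)) (countdown q))" for i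
    \<comment> \<open>Cell 3 is absent from this invariant, since every row reloads it from cell
      1.\<close>
    define Inv where "Inv k s \<longleftrightarrow> k \<le> p \<and> fst s 0 = int p \<and> fst s 1 = int q \<and>
      fst s 2 = int k \<and> fst s 4 = 1 \<and> snd s @ concat (map row (countdown k)) = goal" for k and s :: state
    let ?inner = "WhilePos 3 (Seq body (Sub 3 3 4))"
    let ?outer = "Seq (Seq (Const 3 0) (Add 3 3 1)) (Seq ?inner (Sub 2 2 4))"
    have rows: "concat (map f (grid_list p q)) = concat (map row (countdown p))"
    proof -
      have "concat (map f (List.product xs (countdown q))) = concat (map row xs)" for xs
        by (induction xs) (simp_all add: row_def comp_def)
      then show ?thesis by (simp add: grid_list_def)
    qed
    have "\<exists>s' t. t \<le> q * (T + 2) + 4 \<and> exec ?outer s t s' \<and> Inv k s'"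
      if "Inv (Suc k) s" for k s
    proof -
      obtain m out where s: "s = (m, out)" by fastforce
      have reg: "m 0 = int p" "m 1 = int q" "m 2 = int (Suc k)" "m 4 = 1" and k: "Suc k \<in> {1..p}"
        and out: "out @ row (Suc k) @ concat (map row (countdown k)) = goal"
        using that by (auto simp: Inv_def s)
      define m1 where "m1 = m(3 := m 1)"
      have "exec (Seq (Const 3 0) (Add 3 3 1)) s 2 (m1, out)"
        unfolding s m1_def by (rule exec_copy) simp
      moreover have "registers p q (Suc k) q m1"
        using reg by (simp add: registers_def m1_def)
      then obtain t m2 where t: "t \<le> q * (T + 2) + 1" and m2: "registers p q (Suc k) 0 m2"
        and "exec ?inner (m1, out) t (m2, out @ row (Suc k))"
        using exec_grid_row[OF body f k] unfolding row_def by blast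
      moreover have "exec (Sub 2 2 4) (m2, out @ row (Suc k)) 1
          (m2(2 := m2 2 - m2 4), out @ row (Suc k))"
        by (rule exec.Sub)
      ultimately have "exec ?outer s (2 + (t + 1)) (m2(2 := m2 2 - m2 4), out @ row (Suc k))"
        by (intro exec.Seq)
      moreover have "Inv k (m2(2 := m2 2 - m2 4), out @ row (Suc k))"
        using m2 k out by (auto simp: Inv_def registers_def)
      moreover have "2 + (t + 1) \<le> q * (T + 2) + 4"
        using t by simp
      ultimately show ?thesis by blast
    qed
    moreover have "fst s 2 = int k" if "Inv k s" for k s
      using that by (simp add: Inv_def)
    moreover have "Inv p (m(2 := m 0), out)"
      using m by (simp add: Inv_def goal_def rows)
    ultimately have "\<exists>s' t. t \<le> p * (q * (T + 2) + 4 + 1) + 1 \<and>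
        exec (WhilePos 2 ?outer) (m(2 := m 0), out) t s' \<and> Inv 0 s'"
      by (rule exec_countdown)
    then obtain m' t where t: "t \<le> p * (q * (T + 2) + 4 + 1) + 1"
      and loop: "exec (WhilePos 2 ?outer) (m(2 := m 0), out) t (m', goal)"
      and m': "m' 0 = int p" "m' 1 = int q" "m' 4 = 1"
      by (auto simp: Inv_def)
    have "exec (Seq (Const 2 0) (Add 2 2 0)) (m, out) 2 (m(2 := m 0), out)"
      by (rule exec_copy) simp
    then have "exec (for_grid body) (m, out) (2 + t) (m', goal)"
      unfolding for_grid_def using loop by (rule exec.Seq)
    \<comment> \<open>Positivity of \<open>p\<close> and \<open>q\<close> absorbs the lower-order
      terms 5 p and 3 into p q, whence 10 = 2 + 5 + 3.\<close>
    moreover have "2 + t \<le> (T + 10) * (p * q)"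
    proof -
      have "p \<le> p * q" "1 \<le> p * q"
        using pq by simp_all
      moreover have "2 + t \<le> T * (p * q) + 2 * (p * q) + 5 * p + 3"
        using t by (simp add: algebra_simps)
      ultimately show ?thesis
        unfolding distrib_right by linarith
    qed
    ultimately show ?thesis
      using m' unfolding goal_def by blast
  qed
  then show ?thesis by blast
qed

section \<open>The printed records\<close>

definition bar_ints :: "nat \<Rightarrow> nat \<Rightarrow> vertex \<Rightarrow> int list" where
  "bar_ints p q v =
     [int (fst v), int (snd v), bar_left p v, level v, bar_right p q v, level v]"

definition edge_ints :: "nat \<Rightarrow> vertex \<times> vertex \<Rightarrow> int list" where
  "edge_ints p e = (case e of (u, v) \<Rightarrow>
     [int (fst u), int (snd u), int (fst v), int (snd v),
      edge_column p u v, level u, edge_column p u v, level v])"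

text \<open>Each edge is listed at its lower end only, hence just once. The guard
  \<open>1 < j\<close> keeps the natural subtraction from leaving the grid.\<close>

definition edges_from :: "nat \<Rightarrow> nat \<Rightarrow> vertex \<Rightarrow> (vertex \<times> vertex) list" where
  "edges_from p q v = (case v of (i, j) \<Rightarrow>
     (if j < q then [((i, j), (i, j + 1))] else []) @
     (if i < p then [((i, j), (i + 1, j))] else []) @
     (if i < p \<and> j < q then [((i, j), (i + 1, j + 1))] else []) @
     (if i < p \<and> 1 < j then [((i, j), (i + 1, j - 1))] else []))"

definition edge_list :: "nat \<Rightarrow> nat \<Rightarrow> (vertex \<times> vertex) list" where
  "edge_list p q = concat (map (edges_from p q) (grid_list p q))"

lemma set_edge_list:
  "set (edge_list p q) =
    {(u, v). u \<in> grid_vertices p q \<and> v \<in> grid_vertices p q \<and> upward u v}"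
proof -
  have "(u, v) \<in> set (edges_from p q w) \<longleftrightarrow> w = u \<and> v \<in> grid_vertices p q \<and> upward u v"
    if "w \<in> grid_vertices p q" for u v w
    using that by (cases u; cases v; cases w)
      (auto simp: edges_from_def grid_vertices_def upward_def)
  then show ?thesis
    by (fastforce simp: edge_list_def set_grid_list)
qed

text \<open>\<open>tag\<close> recovers from an entry the element whose list contains it, so lists
  of different elements are disjoint.\<close>

lemma distinct_concat_map_tagged:
  assumes "distinct xs" "\<And>x. x \<in> set xs \<Longrightarrow> distinct (h x)"
    "\<And>x y. x \<in> set xs \<Longrightarrow> y \<in> set (h x) \<Longrightarrow> tag y = x"
  shows "distinct (concat (map h xs))"
  using assms
proof (induction xs)
  case (Cons x xs)
  have "y \<notin> set (h x')" if "y \<in> set (h x)" "x' \<in> set xs" for y x'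
    using Cons.prems(1) Cons.prems(3)[of x y] Cons.prems(3)[of x' y] that by auto
  then have "set (h x) \<inter> set (concat (map h xs)) = {}"
    by auto
  with Cons show ?case by simp
qed simp

lemma distinct_edge_list: "distinct (edge_list p q)"
  unfolding edge_list_def
proof (rule distinct_concat_map_tagged[where tag = fst])
  show "distinct (edges_from p q v)" for v
    by (cases v) (auto simp: edges_from_def)
  show "fst e = v" if "e \<in> set (edges_from p q v)" for v e
    using that by (cases v) (auto simp: edges_from_def split: if_splits)
qed (rule distinct_grid_list)

lemma concat_map_concat:
  "concat (map g (concat (map h xs))) = concat (map (\<lambda>x. concat (map g (h x))) xs)"
  by (induction xs) simp_all

lemma encodes_grid_drawing:
  assumes "out = concat (map (bar_ints p q) (grid_list p q)) @
    concat (map (edge_ints p) (edge_list p q))"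
  shows "encodes_drawing out (grid_vertices p q) (diagonal_grid_edges p q) (grid_drawing p q)"
  unfolding encodes_drawing_def
proof (intro exI conjI)
  let ?ends = "\<lambda>(u :: vertex, v). {u, v}"
  \<comment> \<open>Distinct oriented pairs must remain distinct as unordered edges; uniqueness of
    the orientation gives this.\<close>
  have "inj_on ?ends (set (edge_list p q))"
  proof (rule inj_onI)
    fix d e
    assume "d \<in> set (edge_list p q)" "e \<in> set (edge_list p q)" "?ends d = ?ends e"
    then have "fst d = fst e \<and> snd d = snd e"
      by (intro upward_unique) (auto simp only: set_edge_list split_beta mem_Collect_eq)
    then show "d = e"
      by (simp add: prod_eq_iff)
  qed
  then show "distinct (map ?ends (edge_list p q))"
    using distinct_edge_list by (simp add: distinct_map)
  show "set (map ?ends (edge_list p q)) = diagonal_grid_edges p q"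
    unfolding diagonal_grid_edges_upward set_map set_edge_list by auto
  have "map real_of_int (bar_ints p q v) = bar_record (grid_drawing p q) v" for v
    by (cases v) (simp add: bar_ints_def bar_record_def grid_drawing_def)
  moreover have "map real_of_int (edge_ints p e) = edge_record (grid_drawing p q) e"
    if "e \<in> set (edge_list p q)" for e
  proof -
    obtain i j k l where e: "e = ((i, j), (k, l))"
      by (metis surj_pair)
    have "upward (i, j) (k, l)"
      using that by (simp add: set_edge_list e)
    then show ?thesis
      by (simp add: e edge_ints_def edge_record_def edge_segment_upward upward_segment_def
          Let_def)
  qed
  ultimately show "map real_of_int out =
      concat (map (bar_record (grid_drawing p q)) (grid_list p q)) @
      concat (map (edge_record (grid_drawing p q)) (edge_list p q))"
    unfolding assms map_append map_concat map_map comp_def by (simp cong: map_cong)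
qed (simp_all add: set_grid_list distinct_grid_list)

section \<open>The two loop bodies\<close>

text \<open>Cell 17 only serves as the target of instructions without effect.\<close>

definition block :: "com list \<Rightarrow> com" where
  "block cs = foldr Seq cs (Const 17 0)"

definition when_pos :: "nat \<Rightarrow> com \<Rightarrow> com" where
  "when_pos x c = IfPos x c (Const 17 0)"

definition print_cells :: "nat list \<Rightarrow> com" where
  "print_cells xs = block (map Print xs)"

lemma run_block [simp]:
  "run (block []) s = ((fst s)(17 := 0), snd s)"
  "run (block (c # cs)) s = run (block cs) (run c s)"
  by (simp_all add: block_def)

lemma straight_block [simp]: "straight (block cs) \<longleftrightarrow> (\<forall>c\<in>set cs. straight c)"
  by (induction cs) (simp_all add: block_def)

lemma run_print_cells [simp]:
  "run (print_cells xs) s = ((fst s)(17 := 0), snd s @ map (fst s) xs)"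
  by (induction xs arbitrary: s) (simp_all add: print_cells_def)

lemma straight_print_cells [simp]: "straight (print_cells xs)"
  by (simp add: print_cells_def)

lemma run_when_pos [simp]:
  "run (when_pos x c) s = (if fst s x > 0 then run c s else ((fst s)(17 := 0), snd s))"
  by (simp add: when_pos_def)

lemma straight_when_pos [simp]: "straight (when_pos x c) \<longleftrightarrow> straight c"
  by (simp add: when_pos_def)

text \<open>Leaves the level and the column of the current vertex in cells 5 and 6.\<close>

definition locate :: com where
  "locate = block
     [Add 5 2 2, Add 5 5 3, Const 7 3, Sub 5 5 7,
      Add 6 0 3, Sub 6 6 2, Sub 6 6 4, Add 7 6 6, Add 6 6 7]"

text \<open>Maximum and minimum become sign tests: cell 9 is cleared if its negative is positive,
  and cell 10 is reduced by its excess over the last column, 3 (p + q) - 4, kept in cell 11.\<close>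

definition print_bar :: com where
  "print_bar = block
     [locate, Const 8 3,
      Sub 9 6 8, Const 10 0, Sub 10 10 9, when_pos 10 (Const 9 0),
      Add 10 6 8, Add 11 0 1, Add 12 11 11, Add 11 11 12, Sub 11 11 8, Sub 11 11 4,
      Sub 12 10 11, when_pos 12 (Sub 10 10 12),
      print_cells [2, 3, 9, 5, 10, 5]]"

text \<open>Cells 15, 16 and 9 hold p - i, q - j and j - 1; their signs decide which neighbours
  exist. The four conditional prints follow the order in \<open>edges_from\<close>.\<close>

definition print_edges :: com where
  "print_edges = block
     [locate, Add 7 2 4, Add 8 3 4, Sub 9 3 4, Add 10 5 4, Add 11 10 4, Add 12 11 4,
      Sub 13 6 4, Sub 14 13 4, Sub 14 14 4, Sub 15 0 2, Sub 16 1 3,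
      when_pos 16 (print_cells [2, 3, 2, 8, 6, 5, 6, 10]),
      when_pos 15 (print_cells [2, 3, 7, 3, 6, 5, 6, 11]),
      when_pos 15 (when_pos 16 (print_cells [2, 3, 7, 8, 13, 5, 13, 12])),
      when_pos 15 (when_pos 9 (print_cells [2, 3, 7, 9, 14, 5, 14, 10]))]"

lemma straight_print_bar: "straight print_bar"
  by (simp add: print_bar_def locate_def)

lemma straight_print_edges: "straight print_edges"
  by (simp add: print_edges_def locate_def)

lemma run_locate:
  assumes "registers p q i j m"
  obtains m' where "run locate (m, out) = (m', out)" "registers p q i j m'"
    "m' 5 = level (i, j)" "m' 6 = column p (i, j)"
  using assms by (simp add: locate_def registers_def level_def column_def)

lemma print_bar_prints: "prints_at p q print_bar (bar_ints p q)"
  unfolding prints_at_def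
proof (intro ballI allI impI)
  fix i j m out
  assume "registers p q i j m"
  then obtain m' where m': "run locate (m, out) = (m', out)" "registers p q i j m'"
    "m' 5 = level (i, j)" "m' 6 = column p (i, j)"
    by (rule run_locate)
  then show "\<exists>m'. run print_bar (m, out) = (m', out @ bar_ints p q (i, j)) \<and>
      registers p q i j m'"
    by (simp add: print_bar_def registers_def bar_ints_def bar_left_def bar_right_def)
qed

lemma print_edges_prints:
  "prints_at p q print_edges (\<lambda>v. concat (map (edge_ints p) (edges_from p q v)))"
  unfolding prints_at_def
proof (intro ballI allI impI)
  fix i j m out
  assume "i \<in> {1..p}" "j \<in> {1..q}" "registers p q i j m"
  then obtain m' where m': "run locate (m, out) = (m', out)" "registers p q i j m'"
    "m' 5 = level (i, j)" "m' 6 = column p (i, j)"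
    using run_locate by blast
  then show "\<exists>m'. run print_edges (m, out) =
        (m', out @ concat (map (edge_ints p) (edges_from p q (i, j)))) \<and>
      registers p q i j m'"
    \<comment> \<open>These three conditions settle both the guards in \<open>edges_from\<close> and
      the sign tests of the program.\<close>
    by (cases "i < p"; cases "j < q"; cases "1 < j")
      (simp_all add: print_edges_def registers_def edges_from_def edge_ints_def edge_column_def
        level_def, auto)
qed

section \<open>The whole program and its running time\<close>

definition draw :: com where
  "draw = Seq (Const 4 1) (Seq (for_grid print_bar) (for_grid print_edges))"

text \<open>The first traversal preserves cells 0, 1 and 4, which is all that the second needs to
  start. The single step that sets cell 4 is absorbed by 1 \<le> p q.\<close>

lemma exec_draw:
  "\<exists>c. \<forall>p q. 1 \<le> p \<and> 1 \<le> q \<longrightarrow>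
    (\<exists>t m. t \<le> c * (p * q) \<and>
      exec draw (input_state p q) t
        (m, concat (map (bar_ints p q) (grid_list p q)) @
            concat (map (edge_ints p) (edge_list p q))))"
proof -
  obtain b where b: "\<And>p q f m out. 1 \<le> p \<Longrightarrow> 1 \<le> q \<Longrightarrow> prints_at p q print_bar f \<Longrightarrow>
      m 0 = int p \<Longrightarrow> m 1 = int q \<Longrightarrow> m 4 = 1 \<Longrightarrow>
      \<exists>t m'. t \<le> b * (p * q) \<and> m' 0 = int p \<and> m' 1 = int q \<and> m' 4 = 1 \<and>
        exec (for_grid print_bar) (m, out) t (m', out @ concat (map f (grid_list p q)))"
    using exec_for_grid[OF straight_print_bar] by blast
  obtain e where e: "\<And>p q f m out. 1 \<le> p \<Longrightarrow> 1 \<le> q \<Longrightarrow> prints_at p q print_edges f \<Longrightarrow>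
      m 0 = int p \<Longrightarrow> m 1 = int q \<Longrightarrow> m 4 = 1 \<Longrightarrow>
      \<exists>t m'. t \<le> e * (p * q) \<and> m' 0 = int p \<and> m' 1 = int q \<and> m' 4 = 1 \<and>
        exec (for_grid print_edges) (m, out) t (m', out @ concat (map f (grid_list p q)))"
    using exec_for_grid[OF straight_print_edges] by blast
  have "\<exists>t m. t \<le> (1 + b + e) * (p * q) \<and>
      exec draw (input_state p q) t
        (m, concat (map (bar_ints p q) (grid_list p q)) @
            concat (map (edge_ints p) (edge_list p q)))"
    if pq: "1 \<le> p" "1 \<le> q" for p q
  proof -
    define m0 :: "nat \<Rightarrow> int" where "m0 = (\<lambda>_. 0)(0 := int p, 1 := int q, 4 := 1)"
    have 0: "m0 0 = int p" "m0 1 = int q" "m0 4 = 1"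
      by (simp_all add: m0_def)
    have start: "exec (Const 4 1) (input_state p q) 1 (m0, [])"
      unfolding input_state_def m0_def by (rule exec.Const)
    obtain t1 m1 where 1: "t1 \<le> b * (p * q)" "m1 0 = int p" "m1 1 = int q" "m1 4 = 1"
      "exec (for_grid print_bar) (m0, []) t1
        (m1, [] @ concat (map (bar_ints p q) (grid_list p q)))"
      using b[of p q "bar_ints p q" m0 "[]", OF pq print_bar_prints 0] by blast
    obtain t2 m2 where 2: "t2 \<le> e * (p * q)"
      "exec (for_grid print_edges) (m1, [] @ concat (map (bar_ints p q) (grid_list p q))) t2
        (m2, ([] @ concat (map (bar_ints p q) (grid_list p q))) @
          concat (map (\<lambda>v. concat (map (edge_ints p) (edges_from p q v))) (grid_list p q)))"
      using e[OF pq print_edges_prints 1(2-4)] by blast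
    have "1 + (t1 + t2) \<le> (1 + b + e) * (p * q)"
    proof -
      have "1 \<le> p * q"
        using pq by simp
      with 1(1) 2(1) show ?thesis
        unfolding distrib_right by linarith
    qed
    moreover have "exec draw (input_state p q) (1 + (t1 + t2))
        (m2, concat (map (bar_ints p q) (grid_list p q)) @
          concat (map (edge_ints p) (edge_list p q)))"
      using exec.Seq[OF start exec.Seq[OF 1(5) 2(2)]]
      by (simp add: draw_def edge_list_def concat_map_concat)
    ultimately show ?thesis by blast
  qed
  then show ?thesis by blast
qed

theorem theorem2:
  shows
    "(\<forall>p q :: nat. 1 \<le> p \<and> 1 \<le> q \<longrightarrow>
        (\<exists>\<Gamma>. bar_1_visibility_drawing (grid_vertices p q) (diagonal_grid_edges p q) \<Gamma> \<and>
             drawn_on_grid (q + 2 * p - 2) (3 * (p + q) - 3)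
               (grid_vertices p q) (diagonal_grid_edges p q) \<Gamma>)) \<and>
     (\<exists>(prog :: com) (c :: nat). \<forall>p q :: nat. 1 \<le> p \<and> 1 \<le> q \<longrightarrow>
        (\<exists>\<Gamma> t m out.
             bar_1_visibility_drawing (grid_vertices p q) (diagonal_grid_edges p q) \<Gamma> \<and>
             drawn_on_grid (q + 2 * p - 2) (3 * (p + q) - 3)
               (grid_vertices p q) (diagonal_grid_edges p q) \<Gamma> \<and>
             exec prog (input_state p q) t (m, out) \<and>
             t \<le> c * (p * q) \<and>
             encodes_drawing out (grid_vertices p q) (diagonal_grid_edges p q) \<Gamma>))"
proof (intro conjI)
  show "\<forall>p q :: nat. 1 \<le> p \<and> 1 \<le> q \<longrightarrow>
      (\<exists>\<Gamma>. bar_1_visibility_drawing (grid_vertices p q) (diagonal_grid_edges p q) \<Gamma> \<and>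
        drawn_on_grid (q + 2 * p - 2) (3 * (p + q) - 3)
          (grid_vertices p q) (diagonal_grid_edges p q) \<Gamma>)"
    using grid_drawing_visibility grid_drawing_on_grid by blast
  obtain c where "\<And>p q. 1 \<le> p \<and> 1 \<le> q \<Longrightarrow> \<exists>t m. t \<le> c * (p * q) \<and>
      exec draw (input_state p q) t
        (m, concat (map (bar_ints p q) (grid_list p q)) @
            concat (map (edge_ints p) (edge_list p q)))"
    using exec_draw by blast
  then show "\<exists>(prog :: com) (c :: nat). \<forall>p q :: nat. 1 \<le> p \<and> 1 \<le> q \<longrightarrow>
      (\<exists>\<Gamma> t m out.
        bar_1_visibility_drawing (grid_vertices p q) (diagonal_grid_edges p q) \<Gamma> \<and>
        drawn_on_grid (q + 2 * p - 2) (3 * (p + q) - 3)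
          (grid_vertices p q) (diagonal_grid_edges p q) \<Gamma> \<and>
        exec prog (input_state p q) t (m, out) \<and>
        t \<le> c * (p * q) \<and>
        encodes_drawing out (grid_vertices p q) (diagonal_grid_edges p q) \<Gamma>)"
    using grid_drawing_visibility grid_drawing_on_grid encodes_grid_drawing[OF refl] by meson
qed

end
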